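(* Let $\widehat\beta^{o}$ denote the block oracle estimator, and let $\ell$, $g_\tau$, $\beta^*$ satisfy the standing assumptions in the context. Suppose $\beta^{(0)}\in\mathbb{R}^D$ is any point whose block support is a subset of the block support of $\beta^*$, i.e. $\mathcal{BS}(\mathcal{A}(\beta^{(0)}))\le \mathcal{BS}(\mathcal{A}(\beta^* ))$ entrywise, such that $$\min_{k\in[K_{nz}]}\lambda_{(2)}\big(\mathcal{L}(|\beta^{(0)}_{C_k}|)\big)\ \ge\ b_2\tau ,$$ and suppose $$\|\nabla_{\mathcal{S}^{c}}\,\ell(\widehat\beta^{o})\|_{\max}\ <\ \frac{a_0\tau}{d_{\max}} .$$ Then taking one LLA step from $\beta^{(0)}$ results in $\widehat\beta^{o}$. In particular, if $$\min_{k\in[K_{nz}]}\lambda_{(2)}\big(\mathcal{L}(|\widehat\beta^{o}_{C_k}|)\big)\ge b_2\tau\qquad\text{and}\qquad \|\nabla_{\mathcal{S}^{c}}\,\ell(\widehat\beta^{o})\|_{\max}<\frac{a_0\tau}{d_{\max}},$$ then $\widehat\beta^{o}$ is a fixed point of the LLA algorithm and therefore a stationary point of the problem $\min_{\beta\in\mathbb{R}^D}\ \ell(\beta)+s_\tau(\beta)$.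
   Context: Notation. $D=\binom d2$; vectors $x\in\mathbb{R}^D$ are indexed by unordered pairs $(ij)$, $i\ne j\in[d]$. $\mathcal{A}(x)\in\mathbb{R}^{d\times d}$ is the symmetric matrix with zero diagonal and entries $\mathcal{A}(x)_{ij}=x_{(ij)}$; $\mathcal{L}(x)=\mathrm{diag}(\mathcal{A}(x)\mathbf 1_d)-\mathcal{A}(x)$ is its Laplacian. $|x|$ is the entrywise absolute value, $\|x\|_{\max}=\max_\ell|x_\ell|$, and $\lambda_{(j)}$ is the $j$-th smallest eigenvalue of a symmetric matrix. The connected components of $x$ are those of the graph on $[d]$ with edge $ij$ iff $x_{(ij)}\neq0$ (isolated vertices count as components). The block support $\mathcal{BS}(\mathcal{A}(x))\in\{0,1\}^{d\times d}$ has zero diagonal and $(i,j)$ entry ($i\ne j$) equal to $1$ iff $i,j$ are in the same connected component of $x$. SCAD-like penalty. Given $a_0\ge a_1>0$, $b_2>b_1>0$ and a tuning parameter $\tau$, $g_\tau:[0,\infty)\to\mathbb{R}$ satisfies: (1) $g_\tau$ is increasing and concave with $g_\tau(0)=0$; (2) $g_\tau$ is differentiable on $(0,\infty)$, and $g_\tau'(0):=g_\tau'(0+)=a_0\tau$; (3) $g_\tau'(t)\ge a_1\tau$ for $t\in(0,b_1\tau]$; (4) $g_\tau'(t)=0$ for $t\ge b_2\tau$. The FCLS penalty is $s_\tau(\beta)=\frac12\sum_{i=1}^d g_\tau(\lambda_i(\mathcal{L}(|\beta|)))$. LLA step. For $V\in\mathbb{R}^{d\times K}$ and $w\in\mathbb{R}^K$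 let $\mathcal{M}(V,w)_{(ij)}=\sum_k w_k(V_{ik}-V_{jk})^2$. An LLA step from $b$: let $V$ be an orthonormal matrix of eigenvectors of $\mathcal{L}(|b|)$ with eigenvalues $\lambda$, put $M=\mathcal{M}(V,g'_\tau(\lambda))$; the result is the minimizer over $\beta\in\mathbb{R}^D$ of $\ell(\beta)+\frac12\sum_{(ij)}M_{(ij)}|\beta_{(ij)}|$. The LLA algorithm iterates this step. A fixed point is a $b$ whose LLA step results in $b$. A stationary point of $\ell+s_\tau$ is a $\beta$ satisfying the first-order condition $0=\nabla\ell(\beta)+\frac12 M\odot z$ with $M=\mathcal{M}(V,g'_\tau(\lambda))$ computed from $\mathcal{L}(|\beta|)$ and $z$ some subgradient of $\|\cdot\|_1$ at $\beta$. Target and oracle. $\beta^*\in\mathbb{R}^D$ is a fixed target; $\mathcal{S}$ is the set of pairs $(ij)$ with $i\neq j$ in the same connected component of $\beta^*$, $\mathcal{S}^c$ its complement; $d_{\max}$ is the largest number of nodes in a connected component of $\beta^*$; $C_1,\dots,C_{K_{nz}}$ are the components of $\beta^*$ having at least two nodes. For $\beta \in\mathbb{R}^D$, $\beta_{C_k}$ is the restriction of $\beta$ to pairs inside $C_k$, and $\mathcal{L}(|\beta_{C_k}|)$ is the $|C_k|\times|C_k|$ Laplacian of the graph on the nodes of $C_k$. $\nabla_{\mathcal{S}^c}\ell$ is the gradient restricted to coordinates in $\mathcal{S}^c$. The block oracle $\widehat\beta^{o}$ is the minimizer of $\ell(\beta)$ subject to $\beta_{\mathcal{S}^c}=0$.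 Standing assumptions. $\ell:\mathbb{R}^D\to\mathbb{R}$ is convex (and differentiable); $g_\tau$ is SCAD-like, i.e. $g_\tau$ is increasing and concave on $[0,\infty)$ with $g_\tau(0)=0$, is differentiable on $(0,\infty)$ with $g_\tau'(0):=g_\tau'(0+)=a_0\tau$, and satisfies $g_\tau'(t)\ge a_1\tau$ for $t\in(0,b_1\tau]$ and $g_\tau'(t)=0$ for $t\ge b_2\tau$; and the block oracle problem has the unique solution $\widehat\beta^{o}$, which satisfies $\nabla_{\mathcal{S}}\ell(\widehat\beta^{o})=0$. *)

theory Defs
  imports "HOL-Analysis.Analysis"
begin

section \<open>Vectors indexed by unordered pairs of nodes\<close>

text \<open>
  The node set \<open>[d]\<close> is a finite type \<open>'n\<close>. A vector of \<open>R^D\<close>, \<open>D = d choose 2\<close>, is an element of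
  \<open>real ^ ('n set)\<close> all of whose coordinates at sets other than two-element sets vanish; the
  coordinate at the pair \<open>(ij)\<close> is \<open>x $ {i, j}\<close>. (Taking a subspace rather than an index type of
  pairs keeps the case \<open>d = 1\<close>, \<open>D = 0\<close>.) A function on \<open>R^D\<close> is a function on the ambient space of
  which only the values on \<open>pair_space\<close> are ever used.
\<close>

type_synonym 'n pvec = "real ^ ('n set)"

definition pairs :: "'n set set" where
  "pairs = {e. card e = 2}"

definition pair_space :: "'n::finite pvec set" where
  "pair_space = {x. \<forall>e. e \<notin> pairs \<longrightarrow> x $ e = 0}"

definition pair_gradient :: "('n::finite pvec \<Rightarrow> real) \<Rightarrow> 'n pvec \<Rightarrow> 'n pvec" where
  "pair_gradient loss x =
     (\<chi> e. if e \<in> pairs then deriv (\<lambda>t. loss (x + t *\<^sub>R axis e 1)) 0 else 0)"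

definition l1_norm :: "'n::finite pvec \<Rightarrow> real" where
  "l1_norm x = (\<Sum>e\<in>pairs. \<bar>x $ e\<bar>)"

text \<open>The norm of a restriction to no coordinates is \<open>0\<close>.\<close>

definition max_norm_on :: "'n set set \<Rightarrow> 'n::finite pvec \<Rightarrow> real" where
  "max_norm_on T x = Max (insert 0 ((\<lambda>e. \<bar>x $ e\<bar>) ` T))"

definition subgradient_on :: "'v::real_inner set \<Rightarrow> ('v \<Rightarrow> real) \<Rightarrow> 'v \<Rightarrow> 'v \<Rightarrow> bool" where
  "subgradient_on X f x z \<longleftrightarrow> x \<in> X \<and> z \<in> X \<and> (\<forall>y\<in>X. f y \<ge> f x + z \<bullet> (y - x))"

definition the_minimizer :: "('v \<Rightarrow> real) \<Rightarrow> ('v \<Rightarrow> bool) \<Rightarrow> 'v \<Rightarrow> bool" where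
  "the_minimizer f P x \<longleftrightarrow> (\<forall>y. is_arg_min f P y \<longleftrightarrow> y = x)"


section \<open>Graphs, Laplacians and block supports\<close>

definition adj_matrix :: "'n::finite pvec \<Rightarrow> real ^ 'n ^ 'n" where
  "adj_matrix x = (\<chi> i j. if i = j then 0 else x $ {i, j})"

definition laplacian :: "'n::finite pvec \<Rightarrow> real ^ 'n ^ 'n" where
  "laplacian x = (\<chi> i j. if i = j then (adj_matrix x *v 1) $ i else 0) - adj_matrix x"

definition connected_rel :: "'n::finite pvec \<Rightarrow> ('n \<times> 'n) set" where
  "connected_rel x = {(i, j). i \<noteq> j \<and> x $ {i, j} \<noteq> 0}\<^sup>*"

definition components :: "'n::finite pvec \<Rightarrow> 'n set set" where
  "components x = UNIV // connected_rel x"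

definition block_support :: "'n::finite pvec \<Rightarrow> real ^ 'n ^ 'n" where
  "block_support x = (\<chi> i j. if i \<noteq> j \<and> (i, j) \<in> connected_rel x then 1 else 0)"

definition block_pairs :: "'n::finite pvec \<Rightarrow> 'n set set" where
  "block_pairs x = {{i, j} | i j. i \<noteq> j \<and> (i, j) \<in> connected_rel x}"

definition nontrivial_components :: "'n::finite pvec \<Rightarrow> 'n set set" where
  "nontrivial_components x = {C \<in> components x. card C \<ge> 2}"

definition max_component_size :: "'n::finite pvec \<Rightarrow> nat" where
  "max_component_size x = Max (card ` components x)"

definition restrict_pairs :: "'n set \<Rightarrow> 'n::finite pvec \<Rightarrow> 'n pvec" where
  "restrict_pairs C x = (\<chi> e. if e \<subseteq> C then x $ e else 0)"


section \<open>Eigenvalues\<close>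

text \<open>
  Eigenvalues of the principal submatrix of \<open>A\<close> with rows and columns in \<open>C\<close>; vectors indexed by
  \<open>C\<close> are identified with the vectors over all nodes that vanish outside \<open>C\<close>. Only symmetric
  matrices are considered, so the multiplicity of an eigenvalue is the dimension of its eigenspace.
\<close>

definition eigenspace_on :: "'n set \<Rightarrow> real ^ 'n ^ 'n \<Rightarrow> real \<Rightarrow> (real ^ 'n::finite) set" where
  "eigenspace_on C A \<mu> =
     {x. (\<forall>i. i \<notin> C \<longrightarrow> x $ i = 0) \<and> (\<forall>i\<in>C. (\<Sum>j\<in>C. A $ i $ j * x $ j) = \<mu> * x $ i)}"

definition sorted_eigenvalues :: "'n set \<Rightarrow> real ^ 'n ^ 'n::finite \<Rightarrow> real list" where
  "sorted_eigenvalues C A =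
     concat (map (\<lambda>\<mu>. replicate (dim (eigenspace_on C A \<mu>)) \<mu>)
       (sorted_list_of_set {\<mu>. eigenspace_on C A \<mu> \<noteq> {0}}))"

definition kth_eigenvalue :: "nat \<Rightarrow> 'n set \<Rightarrow> real ^ 'n ^ 'n::finite \<Rightarrow> real" where
  "kth_eigenvalue k C A = sorted_eigenvalues C A ! (k - 1)"

definition block_lambda2 :: "'n::finite pvec \<Rightarrow> 'n set \<Rightarrow> real" where
  "block_lambda2 x C = kth_eigenvalue 2 C (laplacian \<bar>restrict_pairs C x\<bar>)"

definition spectral_decomposition ::
    "real ^ 'n ^ 'n \<Rightarrow> real ^ 'n ^ 'n \<Rightarrow> real ^ 'n::finite \<Rightarrow> bool" where
  "spectral_decomposition A V ev \<longleftrightarrow>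
     orthogonal_matrix V \<and> (\<forall>k. A *v column k V = ev $ k *\<^sub>R column k V)"


section \<open>SCAD-like penalties, the LLA step and stationary points\<close>

text \<open>The derivative on \<open>[0, \<infinity>)\<close>; at \<open>0\<close> it is the right limit of the derivative.\<close>

definition pen_deriv :: "(real \<Rightarrow> real) \<Rightarrow> real \<Rightarrow> real" where
  "pen_deriv g t = (if t = 0 then Lim (at_right 0) (deriv g) else deriv g t)"

definition scad_like ::
    "real \<Rightarrow> real \<Rightarrow> real \<Rightarrow> real \<Rightarrow> real \<Rightarrow> (real \<Rightarrow> real) \<Rightarrow> bool" where
  "scad_like a0 a1 b1 b2 \<tau> g \<longleftrightarrow>
     mono_on {0..} g \<and> concave_on {0..} g \<and> g 0 = 0 \<and>
     (\<forall>t>0. g differentiable (at t)) \<and> (deriv g \<longlongrightarrow> a0 * \<tau>) (at_right 0) \<and>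
     (\<forall>t\<in>{0<..b1 * \<tau>}. deriv g t \<ge> a1 * \<tau>) \<and>
     (\<forall>t\<ge>0. t \<ge> b2 * \<tau> \<longrightarrow> pen_deriv g t = 0)"

definition fcls_penalty :: "(real \<Rightarrow> real) \<Rightarrow> 'n::finite pvec \<Rightarrow> real" where
  "fcls_penalty g x = 1/2 * sum_list (map g (sorted_eigenvalues UNIV (laplacian \<bar>x\<bar>)))"

text \<open>
  The coordinate at \<open>{i, j}\<close> is \<open>\<Sum>k. w_k (V_ik - V_jk)^2\<close>, see the lemma below; the factor
  \<open>1/2\<close> accounts for the two orderings of the pair.
\<close>

definition lla_weights :: "real ^ 'k ^ 'n \<Rightarrow> real ^ 'k \<Rightarrow> 'n::finite pvec" where
  "lla_weights V w = (\<chi> e. if e \<in> pairs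
     then \<Sum>k\<in>UNIV. w $ k * (1/2 * (\<Sum>i\<in>e. \<Sum>j\<in>e. (V $ i $ k - V $ j $ k)\<^sup>2)) else 0)"

lemma lla_weights_pair:
  assumes "i \<noteq> j"
  shows "lla_weights V w $ {i, j} = (\<Sum>k\<in>UNIV. w $ k * (V $ i $ k - V $ j $ k)\<^sup>2)"
  using assms by (simp add: lla_weights_def pairs_def power2_commute)

definition lla_objective ::
    "('n::finite pvec \<Rightarrow> real) \<Rightarrow> 'n pvec \<Rightarrow> 'n pvec \<Rightarrow> real" where
  "lla_objective loss M x = loss x + 1/2 * (\<Sum>e\<in>pairs. M $ e * \<bar>x $ e\<bar>)"

text \<open>
  The eigenvector matrix is not unique; the step from \<open>b\<close> results in \<open>r\<close> if \<open>r\<close> is obtained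
  whichever one is chosen. The first conjunct rules out vacuity.
\<close>

definition lla_step ::
    "('n::finite pvec \<Rightarrow> real) \<Rightarrow> (real \<Rightarrow> real) \<Rightarrow> 'n pvec \<Rightarrow> 'n pvec \<Rightarrow> bool" where
  "lla_step loss g b r \<longleftrightarrow>
     (\<exists>V ev. spectral_decomposition (laplacian \<bar>b\<bar>) V ev) \<and>
     (\<forall>V ev. spectral_decomposition (laplacian \<bar>b\<bar>) V ev \<longrightarrow>
        the_minimizer (lla_objective loss (lla_weights V (\<chi> k. pen_deriv g (ev $ k))))
          (\<lambda>x. x \<in> pair_space) r)"

definition lla_fixed_point ::
    "('n::finite pvec \<Rightarrow> real) \<Rightarrow> (real \<Rightarrow> real) \<Rightarrow> 'n pvec \<Rightarrow> bool" where
  "lla_fixed_point loss g b \<longleftrightarrow> lla_step loss g b b"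

text \<open>First-order condition for minimizing \<open>loss x + fcls_penalty g x\<close> over \<open>x\<close> in \<open>R^D\<close>.\<close>

definition fcls_stationary_point ::
    "('n::finite pvec \<Rightarrow> real) \<Rightarrow> (real \<Rightarrow> real) \<Rightarrow> 'n pvec \<Rightarrow> bool" where
  "fcls_stationary_point loss g x \<longleftrightarrow> x \<in> pair_space \<and>
     (\<exists>V ev z. spectral_decomposition (laplacian \<bar>x\<bar>) V ev \<and>
        subgradient_on pair_space l1_norm x z \<and>
        (let M = lla_weights V (\<chi> k. pen_deriv g (ev $ k))
         in 0 = pair_gradient loss x + (1/2) *\<^sub>R (\<chi> e. M $ e * z $ e)))"


section \<open>The block estimator with known support\<close>

definition is_block_oracle :: "('n::finite pvec \<Rightarrow> real) \<Rightarrow> 'n pvec \<Rightarrow> 'n pvec \<Rightarrow> bool" where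
  "is_block_oracle loss \<beta>s \<beta>o \<longleftrightarrow>
     the_minimizer loss (\<lambda>x. x \<in> pair_space \<and> (\<forall>e \<in> pairs - block_pairs \<beta>s. x $ e = 0)) \<beta>o"

end

theory Submission
  imports Defs
begin

text \<open>
  Write \<open>R\<close> for the partition of the nodes into components of the target \<open>\<beta>s\<close>. If the block support
  of the starting point \<open>b\<close> refines \<open>R\<close>, its Laplacian is block diagonal along \<open>R\<close>, so an eigenvector
  restricts to each block as an eigenvector of that block, or to zero. The lower bound on the second
  block eigenvalues leaves two kinds of eigenvalues: \<open>0\<close>, whose eigenvectors are exactly the vectors
  constant on every block, and eigenvalues \<open>\<ge> b2 * \<tau>\<close>, where the derivative of the penalty is \<open>0\<close>.
  Only the null space therefore enters the weights of the step: up to the factor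
  \<open>pen_deriv g 0 = a0 * \<tau>\<close>, the weight at \<open>{i, j}\<close> is the squared length of the projection of
  \<open>e_i - e_j\<close> onto the blockwise constant vectors. It vanishes if \<open>i\<close> and \<open>j\<close> share a block. Otherwise
  it is at least \<open>1/|C| + 1/|C'| \<ge> 2/d_max\<close> for the blocks \<open>C\<close> and \<open>C'\<close> of \<open>i\<close> and \<open>j\<close>, which follows
  from Cauchy-Schwarz with the blockwise constant test vector \<open>1_C/|C| - 1_C'/|C'|\<close>. These two facts
  are \<open>lla_weights_zero_within_blocks\<close> and \<open>lla_weights_ge_across_blocks\<close>; they hold for every
  choice of eigenvectors.

  The step thus minimizes the loss plus an \<open>l1\<close> term on the pairs across blocks only, with each
  coefficient larger than the modulus of the loss gradient at the oracle. By the gradient inequality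
  for convex functions, any nonzero coordinate across blocks strictly increases this objective above
  its value at the oracle; among the remaining points the objective is the loss, and the oracle is its
  unique minimizer (\<open>block_oracle_minimizes_lla_objective\<close>). The oracle itself has a block support that
  refines \<open>R\<close>, which gives the fixed point. For stationarity, the coordinates across blocks vanish, so
  the subgradient there may be any number in \<open>[-1, 1]\<close>, in particular the one that cancels the gradient
  (\<open>fcls_stationary_pointI\<close>).

  Both the existence of an eigenvector matrix and the finiteness of the spectrum that makes the sorted
  list of eigenvalues meaningful come from the spectral theorem for symmetric matrices, which is proved
  first by maximizing the Rayleigh quotient.
\<close>

section \<open>The spectral theorem for real symmetric matrices\<close>

text \<open>
  The quadratic form \<open>x \<bullet> f x\<close> attains a maximum on the unit sphere of \<open>S\<close>, say at \<open>v\<close> with value \<open>\<mu>\<close>.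
  The residual \<open>w = f v - \<mu> v\<close> is orthogonal to \<open>v\<close>, and moving from \<open>v\<close> in its direction changes the
  form by a first-order term \<open>2 t |w|\<^sup>2\<close>, which must vanish at a maximum.
\<close>

lemma selfadjoint_eigenvector_exists:
  fixes f :: "'a::euclidean_space \<Rightarrow> 'a"
  assumes lin: "linear f" and sub: "subspace S" and inv: "f ` S \<subseteq> S"
    and self: "\<And>x y. f x \<bullet> y = x \<bullet> f y" and nontriv: "S \<noteq> {0}"
  obtains v \<mu> where "v \<in> S" "norm v = 1" "f v = \<mu> *\<^sub>R v"
proof -
  obtain u where u: "u \<in> S" "u \<noteq> 0"
    using nontriv subspace_0[OF sub] by blast
  define K where "K = S \<inter> sphere 0 1"
  have "compact K"
    unfolding K_def by (rule closed_Int_compact[OF closed_subspace[OF sub] compact_sphere])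
  moreover have "(1 / norm u) *\<^sub>R u \<in> K"
    using u subspace_mul[OF sub] by (simp add: K_def)
  then have "K \<noteq> {}" by blast
  moreover have "continuous_on K (\<lambda>x. x \<bullet> f x)"
    using lin by (intro continuous_intros linear_continuous_on) (simp add: linear_conv_bounded_linear)
  ultimately obtain v where v: "v \<in> K" and maxi: "\<And>x. x \<in> K \<Longrightarrow> x \<bullet> f x \<le> v \<bullet> f v"
    using continuous_attains_sup by metis
  define \<mu> where "\<mu> = v \<bullet> f v"
  have vS: "v \<in> S" and nv: "norm v = 1" using v by (auto simp: K_def)
  have homog: "x \<bullet> f x \<le> \<mu> * (x \<bullet> x)" if "x \<in> S" for x
  proof (cases "x = 0")
    case False
    define c where "c = 1 / norm x"
    have "c *\<^sub>R x \<in> K" using that False subspace_mul[OF sub] by (simp add: K_def c_def)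
    from maxi[OF this] have "c^2 * (x \<bullet> f x) \<le> \<mu>"
      using linear_cmul[OF lin] by (simp add: \<mu>_def power2_eq_square mult.assoc)
    then show ?thesis
      using False by (simp add: c_def power2_norm_eq_inner field_simps)
  qed (simp add: linear_0[OF lin])
  define w where "w = f v - \<mu> *\<^sub>R v"
  have wS: "w \<in> S"
    using inv vS sub by (auto simp: w_def intro!: subspace_diff subspace_mul)
  have vv: "v \<bullet> v = 1" using nv by (simp add: norm_eq_1)
  have wv: "w \<bullet> v = 0" by (simp add: w_def inner_diff_left vv \<mu>_def inner_commute[of "f v"])
  have wfv: "w \<bullet> f v = w \<bullet> w"
    using wv by (simp add: inner_diff_right w_def)
  define c where "c = w \<bullet> f w - \<mu> * (w \<bullet> w)"
  have variation: "2 * t * (w \<bullet> w) + t^2 * c \<le> 0" for t :: real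
  proof -
    have "v + t *\<^sub>R w \<in> S" using vS wS sub by (intro subspace_add subspace_mul)
    from homog[OF this] show ?thesis
      using wv wfv vv self[of v w]
      by (simp add: linear_add[OF lin] linear_cmul[OF lin] inner_add_left inner_add_right
          c_def algebra_simps power2_eq_square inner_commute \<mu>_def[symmetric])
  qed
  \<comment> \<open>A step so short that the quadratic term of the variation cannot offset the linear one.\<close>
  define t where "t = (w \<bullet> w) / (1 + \<bar>c\<bar>)"
  have "t * (1 + \<bar>c\<bar>) = w \<bullet> w" by (simp add: t_def)
  have "t \<ge> 0" by (simp add: t_def)
  have "w \<bullet> w \<le> 0"
  proof (rule ccontr)
    assume "\<not> w \<bullet> w \<le> 0"
    then have "w \<bullet> w > 0" by linarith
    then have "t > 0" unfolding t_def by (intro divide_pos_pos) auto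
    have "t * (2 * (w \<bullet> w) + t * c) \<le> 0"
      using variation[of t] by (simp add: algebra_simps power2_eq_square)
    with \<open>t > 0\<close> have "2 * (w \<bullet> w) + t * c \<le> 0"
      by (simp add: mult_le_0_iff)
    moreover have "t * c \<ge> - (t * \<bar>c\<bar>)"
      using mult_left_mono[OF abs_ge_minus_self[of c] \<open>t \<ge> 0\<close>] by simp
    ultimately show False
      using \<open>t * (1 + \<bar>c\<bar>) = w \<bullet> w\<close> \<open>t > 0\<close> \<open>\<not> w \<bullet> w \<le> 0\<close> by (simp add: algebra_simps)
  qed
  then have "w = 0" using inner_gt_zero_iff[of w] by linarith
  then have "f v = \<mu> *\<^sub>R v" by (simp add: w_def)
  with vS nv that show thesis by blast
qed

text \<open>
  Induction on the dimension: the orthogonal complement in \<open>S\<close> of one eigenvector is again invariant,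
  because \<open>f\<close> is self-adjoint. The basis of \<open>S\<close> is built from that of the complement.
\<close>

lemma selfadjoint_orthonormal_eigenbasis:
  fixes f :: "'a::euclidean_space \<Rightarrow> 'a"
  assumes lin: "linear f" and self: "\<And>x y. f x \<bullet> y = x \<bullet> f y"
    and sub: "subspace S" and inv: "f ` S \<subseteq> S"
  shows "\<exists>B \<subseteq> S. pairwise orthogonal B \<and> (\<forall>v\<in>B. norm v = 1 \<and> (\<exists>\<mu>. f v = \<mu> *\<^sub>R v)) \<and> span B = S"
  using sub inv
proof (induction "dim S" arbitrary: S rule: less_induct)
  case less
  show ?case
  proof (cases "S = {0}")
    case True
    then show ?thesis by (intro exI[of _ "{}"]) auto
  next
    case False
    obtain v \<mu> where v: "v \<in> S" "norm v = 1" "f v = \<mu> *\<^sub>R v"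
      using selfadjoint_eigenvector_exists[OF lin less.prems self False] .
    have vv: "v \<bullet> v = 1" using v by (simp add: norm_eq_1)
    define T where "T = S \<inter> {x. v \<bullet> x = 0}"
    have T: "subspace T"
      unfolding T_def by (intro subspace_inter less.prems subspace_hyperplane)
    have "v \<notin> T" using vv by (simp add: T_def)
    then have "T \<subset> S" using v unfolding T_def by blast
    then have "dim T < dim S"
      using dim_psubset[of T S] T less.prems(1) by (metis span_eq_iff)
    moreover have "f ` T \<subseteq> T"
      using less.prems(2) v(3) by (auto simp: T_def self[symmetric])
    ultimately obtain B where B: "B \<subseteq> T" "pairwise orthogonal B" "span B = T"
        "\<forall>v\<in>B. norm v = 1 \<and> (\<exists>\<mu>. f v = \<mu> *\<^sub>R v)"
      using less.hyps[OF _ T] by blast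
    have "x \<in> span (insert v B)" if "x \<in> S" for x
    proof -
      have "x - (v \<bullet> x) *\<^sub>R v \<in> T"
        using that v vv less.prems(1)
        by (auto simp: T_def inner_diff_right intro!: subspace_diff subspace_mul)
      then show ?thesis unfolding span_insert using B(3) by blast
    qed
    moreover have "span (insert v B) \<subseteq> S"
      using B(1) v less.prems(1) by (intro span_minimal) (auto simp: T_def)
    ultimately have "span (insert v B) = S" by blast
    moreover have "pairwise orthogonal (insert v B)"
      using B(1,2) by (auto simp: pairwise_insert T_def orthogonal_def inner_commute)
    moreover have "insert v B \<subseteq> S" using B(1) v by (auto simp: T_def)
    ultimately show ?thesis using B(4) v by (intro exI[of _ "insert v B"]) auto
  qed
qed

lemma symmetric_matrix_selfadjoint:
  fixes A :: "real ^ 'n ^ 'n"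
  assumes "transpose A = A"
  shows "(A *v x) \<bullet> y = x \<bullet> (A *v y)"
  by (metis assms dot_lmul_matrix vector_transpose_matrix)

lemma symmetric_matrix_spectral_decomposition_exists:
  fixes A :: "real ^ 'n::finite ^ 'n"
  assumes "transpose A = A"
  shows "\<exists>V ev. spectral_decomposition A V ev"
proof -
  have "\<exists>B \<subseteq> UNIV. pairwise orthogonal B \<and>
      (\<forall>v\<in>B. norm v = 1 \<and> (\<exists>\<mu>. A *v v = \<mu> *\<^sub>R v)) \<and> span B = UNIV"
    using selfadjoint_orthonormal_eigenbasis[of "(*v) A" UNIV]
      symmetric_matrix_selfadjoint[OF assms] by auto
  then obtain B where B: "pairwise orthogonal B" "span B = UNIV"
      "\<And>v. v \<in> B \<Longrightarrow> norm v = 1" "\<And>v. v \<in> B \<Longrightarrow> \<exists>\<mu>. A *v v = \<mu> *\<^sub>R v"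
    by blast
  have "0 \<notin> B" using B(3) by force
  then have ind: "independent B" using B(1) pairwise_orthogonal_independent by blast
  have "card B = CARD('n)"
    using dim_eq_card[OF _ ind, of UNIV] B(2) by simp
  moreover have "finite B" using ind independent_imp_finite by blast
  ultimately obtain h :: "'n \<Rightarrow> real ^ 'n" where h: "bij_betw h UNIV B"
    using finite_same_card_bij[of "UNIV :: 'n set" B] by auto
  define V :: "real ^ 'n ^ 'n" where "V = (\<chi> i k. h k $ i)"
  have col: "column k V = h k" for k by (simp add: V_def column_def vec_eq_iff)
  have hB: "h k \<in> B" for k using h by (auto simp: bij_betw_def)
  have "orthogonal_matrix V"
    unfolding orthogonal_matrix_orthonormal_columns col
    using B(1,3) hB h by (auto simp: pairwise_def bij_betw_def inj_eq)
  moreover obtain ev where "\<forall>k. A *v h k = ev k *\<^sub>R h k"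
    using choice[of "\<lambda>k \<mu>. A *v h k = \<mu> *\<^sub>R h k"] B(4) hB by blast
  ultimately have "spectral_decomposition A V (\<chi> k. ev k)"
    by (simp add: spectral_decomposition_def col)
  then show ?thesis by blast
qed

text \<open>
  An orthogonal matrix preserves inner products, and the coordinates of its transpose applied to \<open>x\<close>
  are the inner products of \<open>x\<close> with the columns.
\<close>

lemma orthogonal_matrix_parseval:
  fixes V :: "real ^ 'n ^ 'n"
  assumes "orthogonal_matrix V"
  shows "x \<bullet> y = (\<Sum>k\<in>UNIV. (column k V \<bullet> x) * (column k V \<bullet> y))"
proof -
  have coeff: "(transpose V *v z) $ k = column k V \<bullet> z" for z k
    by (simp add: matrix_vector_mult_def transpose_def column_def inner_vec_def)
  have "x \<bullet> y = (transpose V *v x) \<bullet> (transpose V *v y)"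
    using assms
    by (metis dot_lmul_matrix matrix_vector_mul_assoc matrix_vector_mul_lid orthogonal_matrix_def
        vector_transpose_matrix)
  also have "\<dots> = (\<Sum>k\<in>UNIV. (column k V \<bullet> x) * (column k V \<bullet> y))"
    unfolding inner_vec_def[of "transpose V *v x"] coeff by simp
  finally show ?thesis .
qed

lemma eigenvector_orthogonal_column:
  assumes "transpose A = A" "spectral_decomposition A V ev" "A *v x = \<mu> *\<^sub>R x" "ev $ k \<noteq> \<mu>"
  shows "column k V \<bullet> x = 0"
proof -
  have "ev $ k * (column k V \<bullet> x) = \<mu> * (column k V \<bullet> x)"
    using symmetric_matrix_selfadjoint[OF assms(1), of "column k V" x] assms(2,3)
    by (simp add: spectral_decomposition_def)
  with assms(4) show ?thesis by simp
qed

text \<open>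
  An eigenvector for a value that is not listed in \<open>ev\<close> would be orthogonal to every column of \<open>V\<close>. In
  particular the spectrum is finite.
\<close>

lemma eigenvalue_in_spectral_decomposition:
  assumes "transpose A = A" "spectral_decomposition A V ev" "A *v x = \<mu> *\<^sub>R x" "x \<noteq> 0"
  shows "\<mu> \<in> range (($) ev)"
proof (rule ccontr)
  assume "\<mu> \<notin> range (($) ev)"
  then have "column k V \<bullet> x = 0" for k
    using eigenvector_orthogonal_column[OF assms(1-3)] by (metis rangeI)
  then have "x \<bullet> x = 0"
    using assms(2) orthogonal_matrix_parseval[of V x x] by (simp add: spectral_decomposition_def)
  with assms(4) show False by simp
qed

section \<open>Laplacians and their second eigenvalue on a block\<close>

text \<open>
  The difference form of the Laplacian: it makes the action on vectors that are constant along edges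
  visible, and it only involves the edges at the node \<open>i\<close>.
\<close>

lemma laplacian_mult:
  "(laplacian x *v u) $ i = (\<Sum>j\<in>UNIV. adj_matrix x $ i $ j * (u $ i - u $ j))"
proof -
  have comp: "laplacian x $ i $ j * u $ j
      = (if j = i then (adj_matrix x *v 1) $ i * u $ i else 0) - adj_matrix x $ i $ j * u $ j" for j
    by (simp add: laplacian_def left_diff_distrib)
  have deg: "(adj_matrix x *v 1) $ i * u $ i = (\<Sum>j\<in>UNIV. adj_matrix x $ i $ j * u $ i)"
    unfolding matrix_vector_mult_def by (simp add: sum_distrib_right[symmetric])
  have "(laplacian x *v u) $ i = (\<Sum>j\<in>UNIV. laplacian x $ i $ j * u $ j)"
    by (simp add: matrix_vector_mult_def)
  also have "\<dots> = (adj_matrix x *v 1) $ i * u $ i - (\<Sum>j\<in>UNIV. adj_matrix x $ i $ j * u $ j)"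
    unfolding comp by (simp add: sum_subtractf)
  finally show ?thesis
    unfolding deg by (simp add: right_diff_distrib sum_subtractf)
qed

lemma adj_matrix_sym: "adj_matrix x $ i $ j = adj_matrix x $ j $ i"
  by (simp add: adj_matrix_def insert_commute)

lemma transpose_laplacian: "transpose (laplacian x) = laplacian x"
  by (simp add: transpose_def laplacian_def vec_eq_iff adj_matrix_sym[of x])

lemma adj_matrix_abs_nonneg: "adj_matrix \<bar>x\<bar> $ i $ j \<ge> 0"
  by (simp add: adj_matrix_def abs_vec_def)

text \<open>
  Averaging the double sum with the one obtained by exchanging \<open>i\<close> and \<open>j\<close> turns
  \<open>u_i (u_i - u_j)\<close> into half of \<open>(u_i - u_j)\<^sup>2\<close>. With nonnegative edge weights the Laplacian is therefore
  positive semidefinite.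
\<close>

lemma laplacian_quadratic_form:
  "u \<bullet> (laplacian x *v u) = 1/2 * (\<Sum>i\<in>UNIV. \<Sum>j\<in>UNIV. adj_matrix x $ i $ j * (u $ i - u $ j)\<^sup>2)"
proof -
  define w where "w i j = adj_matrix x $ i $ j" for i j
  have *: "u \<bullet> (laplacian x *v u) = (\<Sum>i\<in>UNIV. \<Sum>j\<in>UNIV. w i j * (u $ i * (u $ i - u $ j)))"
    by (simp add: inner_vec_def laplacian_mult sum_distrib_left w_def mult.left_commute)
  also have "\<dots> = (\<Sum>i\<in>UNIV. \<Sum>j\<in>UNIV. w j i * (u $ j * (u $ j - u $ i)))"
    by (rule sum.swap)
  also have "\<dots> = (\<Sum>i\<in>UNIV. \<Sum>j\<in>UNIV. w i j * (u $ j * (u $ j - u $ i)))"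
    unfolding w_def by (intro sum.cong refl arg_cong2[where f = "(*)"] adj_matrix_sym)
  finally have **: "u \<bullet> (laplacian x *v u) = (\<Sum>i\<in>UNIV. \<Sum>j\<in>UNIV. w i j * (u $ j * (u $ j - u $ i)))"
.
  have "(\<Sum>i\<in>UNIV. \<Sum>j\<in>UNIV. w i j * (u $ i - u $ j)\<^sup>2)
      = (\<Sum>i\<in>UNIV. \<Sum>j\<in>UNIV. w i j * (u $ i * (u $ i - u $ j)) + w i j * (u $ j * (u $ j - u $ i)))"
    by (intro sum.cong refl) (simp add: power2_eq_square algebra_simps)
  also have "\<dots> = 2 * (u \<bullet> (laplacian x *v u))"
    using * ** by (simp add: sum.distrib)
  finally show ?thesis by (simp add: w_def)
qed

lemma laplacian_abs_eigenvalue_nonneg: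
  assumes "laplacian \<bar>x\<bar> *v u = \<mu> *\<^sub>R u" "u \<noteq> 0"
  shows "\<mu> \<ge> 0"
proof -
  have "\<mu> * (u \<bullet> u) = u \<bullet> (laplacian \<bar>x\<bar> *v u)" using assms by simp
  also have "\<dots> \<ge> 0"
    unfolding laplacian_quadratic_form
    using adj_matrix_abs_nonneg by (intro mult_nonneg_nonneg sum_nonneg) auto
  finally have "0 \<le> \<mu> * (u \<bullet> u)" .
  moreover have "u \<bullet> u > 0" using assms(2) by simp
  ultimately show ?thesis by (simp only: zero_le_mult_iff) linarith
qed

text \<open>
  Turns the eigenvalue problem of a block into an ordinary one, so that the facts about full symmetric
  matrices apply to blocks.
\<close>

lemma eigenspace_on_zero_rows:
  fixes A :: "real ^ 'n ^ 'n::finite"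
  assumes "\<And>i j. i \<notin> C \<Longrightarrow> A $ i $ j = 0"
  shows "eigenspace_on C A \<mu> = {x. (\<forall>i. i \<notin> C \<longrightarrow> x $ i = 0) \<and> A *v x = \<mu> *\<^sub>R x}"
proof -
  have block_row: "(\<Sum>j\<in>C. A $ i $ j * x $ j) = (A *v x) $ i" if "\<forall>i. i \<notin> C \<longrightarrow> x $ i = 0" for x i
    unfolding matrix_vector_mult_def using that by (auto intro!: sum.mono_neutral_left)
  have zero_row: "(A *v x) $ i = 0" if "i \<notin> C" for x i
    using assms that by (simp add: matrix_vector_mult_def)
  show ?thesis
    unfolding eigenspace_on_def
  proof (intro Collect_cong conj_cong refl)
    fix x :: "real ^ 'n" assume x: "\<forall>i. i \<notin> C \<longrightarrow> x $ i = 0"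
    have "(A *v x) $ i = \<mu> * x $ i" if "i \<notin> C" for i
      using that x zero_row by simp
    then show "(\<forall>i\<in>C. (\<Sum>j\<in>C. A $ i $ j * x $ j) = \<mu> * x $ i) \<longleftrightarrow> A *v x = \<mu> *\<^sub>R x"
      unfolding vec_eq_iff vector_scaleR_component real_scaleR_def block_row[OF x] by blast
  qed
qed

lemma adj_matrix_abs_restrict:
  "adj_matrix \<bar>restrict_pairs C x\<bar> $ i $ j = (if i \<in> C \<and> j \<in> C then adj_matrix \<bar>x\<bar> $ i $ j else 0)"
  by (auto simp: adj_matrix_def restrict_pairs_def abs_vec_def)

lemma eigenspace_on_laplacian_restrict:
  "eigenspace_on C (laplacian \<bar>restrict_pairs C x\<bar>) \<mu>
     = {u. (\<forall>i. i \<notin> C \<longrightarrow> u $ i = 0) \<and> laplacian \<bar>restrict_pairs C x\<bar> *v u = \<mu> *\<^sub>R u}"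
proof (rule eigenspace_on_zero_rows)
  fix i j assume "i \<notin> C"
  then have row: "adj_matrix \<bar>restrict_pairs C x\<bar> $ i $ k = 0" for k
    by (simp add: adj_matrix_abs_restrict)
  then have "(adj_matrix \<bar>restrict_pairs C x\<bar> *v 1) $ i = 0"
    unfolding matrix_vector_mult_def vec_lambda_beta by (intro sum.neutral) simp
  then show "laplacian \<bar>restrict_pairs C x\<bar> $ i $ j = 0"
    using row by (cases "i = j") (auto simp: laplacian_def)
qed

text \<open>
  The list opens with \<open>d \<mu>0\<close> copies of its minimum \<open>\<mu>0\<close>. An entry above \<open>\<mu>0\<close> at index \<open>1\<close> leaves room for
  one copy only, and the next run consists of the least of the remaining values.
\<close>

lemma nth_concat_replicate_second:
  fixes d :: "real \<Rightarrow> nat"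
  assumes "finite E" "\<And>\<mu>. \<mu> \<in> E \<Longrightarrow> d \<mu> \<ge> 1" "\<mu>0 \<in> E" "\<And>\<mu>. \<mu> \<in> E \<Longrightarrow> \<mu>0 \<le> \<mu>"
    and second: "concat (map (\<lambda>\<mu>. replicate (d \<mu>) \<mu>) (sorted_list_of_set E)) ! 1 > \<mu>0"
  shows "d \<mu>0 = 1" and "\<mu> \<in> E - {\<mu>0} \<Longrightarrow>
    concat (map (\<lambda>\<mu>. replicate (d \<mu>) \<mu>) (sorted_list_of_set E)) ! 1 \<le> \<mu>"
proof -
  define L where "L = concat (map (\<lambda>\<mu>. replicate (d \<mu>) \<mu>) (sorted_list_of_set (E - {\<mu>0})))"
  have Min: "Min E = \<mu>0" using assms(1,3,4) by (intro Min_eqI) auto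
  have split: "concat (map (\<lambda>\<mu>. replicate (d \<mu>) \<mu>) (sorted_list_of_set E)) = replicate (d \<mu>0) \<mu>0 @ L"
  proof -
    have "E \<noteq> {}" using assms(3) by blast
    from sorted_list_of_set_nonempty[OF assms(1) this] show ?thesis unfolding Min L_def by simp
  qed
  show d1: "d \<mu>0 = 1"
  proof (rule ccontr)
    assume "d \<mu>0 \<noteq> 1"
    with assms(2)[OF assms(3)] have "1 < d \<mu>0" by simp
    with second show False unfolding split by (simp add: nth_append)
  qed
  show "concat (map (\<lambda>\<mu>. replicate (d \<mu>) \<mu>) (sorted_list_of_set E)) ! 1 \<le> \<mu>" if \<mu>: "\<mu> \<in> E - {\<mu>0}"
  proof -
    define \<nu> where "\<nu> = Min (E - {\<mu>0})"
    have fin: "finite (E - {\<mu>0})" and ne: "E - {\<mu>0} \<noteq> {}" using assms(1) \<mu> by auto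
    have "L = replicate (d \<nu>) \<nu> @ concat (map (\<lambda>\<mu>. replicate (d \<mu>) \<mu>)
        (sorted_list_of_set (E - {\<mu>0} - {\<nu>})))"
      unfolding L_def sorted_list_of_set_nonempty[OF fin ne] \<nu>_def by simp
    moreover have "\<nu> \<in> E" using Min_in[OF fin ne] by (simp add: \<nu>_def)
    then have "d \<nu> \<ge> 1" by (rule assms(2))
    ultimately have "L ! 0 = \<nu>" by (simp add: nth_append)
    moreover have "\<nu> \<le> \<mu>" unfolding \<nu>_def using fin \<mu> by (rule Min_le)
    ultimately show ?thesis unfolding split by (simp add: nth_append d1)
  qed
qed

lemma dim_le_one_multiple:
  fixes E :: "'a::euclidean_space set"
  assumes "dim E \<le> 1" "u \<in> E" "u \<noteq> 0" "x \<in> E"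
  obtains c where "x = c *\<^sub>R u"
proof -
  have "E \<subseteq> span {u}"
    using assms by (intro card_ge_dim_independent) auto
  with assms(4) that show thesis by (auto simp: span_singleton)
qed

text \<open>
  Zero is the least eigenvalue of the Laplacian of the block, with the indicator of \<open>C\<close> as an
  eigenvector. A positive second eigenvalue forces this eigenvalue to be simple, so the indicator spans
  the null space.
\<close>

lemma second_block_eigenvalue_pos:
  assumes "C \<noteq> {}" "block_lambda2 x C > 0"
  shows eigenvalue_ge_block_lambda2:
      "\<And>u \<mu>. u \<in> eigenspace_on C (laplacian \<bar>restrict_pairs C x\<bar>) \<mu> \<Longrightarrow> u \<noteq> 0 \<Longrightarrow> \<mu> \<noteq> 0
        \<Longrightarrow> \<mu> \<ge> block_lambda2 x C"
    and null_space_constant: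
      "\<And>u i j. u \<in> eigenspace_on C (laplacian \<bar>restrict_pairs C x\<bar>) 0 \<Longrightarrow> i \<in> C \<Longrightarrow> j \<in> C
        \<Longrightarrow> u $ i = u $ j"
proof -
  define A where "A = laplacian \<bar>restrict_pairs C x\<bar>"
  define E where "E = {\<mu>. eigenspace_on C A \<mu> \<noteq> {0}}"
  have space: "eigenspace_on C A \<mu> = {u. (\<forall>i. i \<notin> C \<longrightarrow> u $ i = 0) \<and> A *v u = \<mu> *\<^sub>R u}" for \<mu>
    unfolding A_def by (rule eigenspace_on_laplacian_restrict)
  have zero: "0 \<in> eigenspace_on C A \<mu>" for \<mu> by (simp add: space)
  have E_iff: "\<mu> \<in> E \<longleftrightarrow> (\<exists>u\<in>eigenspace_on C A \<mu>. u \<noteq> 0)" for \<mu>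
    using zero[of \<mu>] unfolding E_def by blast
  obtain V ev where "spectral_decomposition A V ev"
    using symmetric_matrix_spectral_decomposition_exists transpose_laplacian unfolding A_def by blast
  then have "\<mu> \<in> range (($) ev)" if "\<mu> \<in> E" for \<mu>
    using that eigenvalue_in_spectral_decomposition[of A V ev _ \<mu>] transpose_laplacian
    unfolding E_iff space by (auto simp: A_def)
  then have "E \<subseteq> range (($) ev)" by blast
  then have fin: "finite E" by (rule finite_subset) simp
  define one :: "real ^ 'a" where "one = (\<chi> i. if i \<in> C then 1 else 0)"
  have "A *v one = 0"
    by (auto simp: A_def vec_eq_iff laplacian_mult adj_matrix_abs_restrict one_def intro!: sum.neutral)
  then have one: "one \<in> eigenspace_on C A 0" by (simp add: space one_def)
  have one0: "one \<noteq> 0" using assms(1) by (auto simp: vec_eq_iff one_def)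
  have E0: "0 \<in> E" using one one0 E_iff by blast
  have nonneg: "\<mu> \<ge> 0" if "\<mu> \<in> E" for \<mu>
    using that laplacian_abs_eigenvalue_nonneg unfolding E_iff space unfolding A_def by blast
  have dim: "dim (eigenspace_on C A \<mu>) \<ge> 1" if "\<mu> \<in> E" for \<mu>
  proof -
    have "\<not> eigenspace_on C A \<mu> \<subseteq> {0}" using that E_iff by blast
    then have "dim (eigenspace_on C A \<mu>) \<noteq> 0" by simp
    then show ?thesis by linarith
  qed
  have lam: "block_lambda2 x C
      = concat (map (\<lambda>\<mu>. replicate (dim (eigenspace_on C A \<mu>)) \<mu>) (sorted_list_of_set E)) ! 1"
    by (simp add: block_lambda2_def kth_eigenvalue_def sorted_eigenvalues_def A_def E_def)
  have dim0: "dim (eigenspace_on C A 0) \<le> 1"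
    by (intro eq_imp_le[OF nth_concat_replicate_second(1)[OF fin _ E0 _ assms(2)[unfolded lam]]] dim nonneg)
  show "\<mu> \<ge> block_lambda2 x C"
    if "u \<in> eigenspace_on C (laplacian \<bar>restrict_pairs C x\<bar>) \<mu>" "u \<noteq> 0" "\<mu> \<noteq> 0" for u \<mu>
  proof -
    have "\<mu> \<in> E - {0}" using that E_iff unfolding A_def by blast
    then show ?thesis
      unfolding lam by (intro nth_concat_replicate_second(2)[OF fin _ E0 _ assms(2)[unfolded lam]] dim nonneg)
  qed
  show "u $ i = u $ j"
    if "u \<in> eigenspace_on C (laplacian \<bar>restrict_pairs C x\<bar>) 0" "i \<in> C" "j \<in> C" for u i j
  proof -
    have "u \<in> eigenspace_on C A 0" using that(1) by (simp only: A_def)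
    then obtain c where "u = c *\<^sub>R one"
      using dim_le_one_multiple[OF dim0 one one0] by metis
    then show ?thesis using that by (simp add: one_def)
  qed
qed

section \<open>Connected components and block support\<close>

lemma equiv_connected_rel: "equiv UNIV (connected_rel x)"
proof (rule equivI)
  show "sym (connected_rel x)"
    unfolding connected_rel_def by (intro sym_rtrancl symI) (auto simp: insert_commute)
qed (auto simp: connected_rel_def refl_rtrancl trans_rtrancl)

lemma connected_rel_refl [simp]: "(i, i) \<in> connected_rel x"
  by (simp add: connected_rel_def)

lemma connected_class_in_components: "connected_rel x `` {i} \<in> components x"
  by (simp add: components_def quotientI)

lemma component_mem_iff:
  assumes "C \<in> components x" "(i, j) \<in> connected_rel x"
  shows "i \<in> C \<longleftrightarrow> j \<in> C"
  using assms equiv_connected_rel[of x] unfolding components_def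
  by (metis in_quotient_imp_closed equivE symD)

lemma block_pairs_iff: "i \<noteq> j \<Longrightarrow> {i, j} \<in> block_pairs x \<longleftrightarrow> (i, j) \<in> connected_rel x"
  using equiv_connected_rel[of x] by (auto simp: block_pairs_def doubleton_eq_iff equiv_def dest: symD)

lemma block_support_le_iff:
  "block_support x \<le> block_support y \<longleftrightarrow> connected_rel x \<subseteq> connected_rel y"
proof
  assume le: "block_support x \<le> block_support y"
  show "connected_rel x \<subseteq> connected_rel y"
  proof (rule subrelI)
    fix i j assume "(i, j) \<in> connected_rel x"
    moreover have "block_support x $ i $ j \<le> block_support y $ i $ j"
      using le by (simp add: less_eq_vec_def)
    ultimately show "(i, j) \<in> connected_rel y"
      by (cases "i = j") (auto simp: block_support_def split: if_splits)
  qed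
qed (auto simp: less_eq_vec_def block_support_def)

text \<open>
  Applied to the oracle, whose coordinates across the blocks of the target vanish by its constraint.
\<close>

lemma connected_rel_mono_of_zero_outside:
  assumes "\<forall>e \<in> pairs - block_pairs y. x $ e = 0"
  shows "connected_rel x \<subseteq> connected_rel y"
proof -
  have "{(i, j). i \<noteq> j \<and> x $ {i, j} \<noteq> 0} \<subseteq> connected_rel y"
  proof (clarify)
    fix i j assume "i \<noteq> j" "x $ {i, j} \<noteq> 0"
    moreover from \<open>i \<noteq> j\<close> have "{i, j} \<in> pairs" by (simp add: pairs_def)
    ultimately have "{i, j} \<in> block_pairs y" using assms by blast
    with \<open>i \<noteq> j\<close> show "(i, j) \<in> connected_rel y" by (simp add: block_pairs_iff)
  qed
  then have "connected_rel x \<subseteq> (connected_rel y)\<^sup>*"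
    unfolding connected_rel_def[of x] by (rule rtrancl_mono)
  then show ?thesis by (simp add: connected_rel_def)
qed

lemma adj_matrix_abs_zero_across:
  assumes "connected_rel b \<subseteq> connected_rel s" "(i, j) \<notin> connected_rel s"
  shows "adj_matrix \<bar>b\<bar> $ i $ j = 0"
proof -
  have "(i, j) \<notin> connected_rel b" using assms by blast
  then have "i = j \<or> b $ {i, j} = 0" unfolding connected_rel_def by blast
  then show ?thesis by (auto simp: adj_matrix_def abs_vec_def)
qed

text \<open>
  No edge leaves a block, so for a node of \<open>C\<close> the sum in the difference form of the Laplacian only
  involves nodes of \<open>C\<close>. The restriction may be zero.
\<close>

lemma eigenvector_restrict_component:
  assumes "connected_rel b \<subseteq> connected_rel s" "C \<in> components s"
    and eig: "laplacian \<bar>b\<bar> *v u = \<mu> *\<^sub>R u"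
  shows "(\<chi> i. if i \<in> C then u $ i else 0) \<in> eigenspace_on C (laplacian \<bar>restrict_pairs C b\<bar>) \<mu>"
    (is "?v \<in> _")
proof -
  have "(laplacian \<bar>restrict_pairs C b\<bar> *v ?v) $ i = (\<mu> *\<^sub>R ?v) $ i" for i
  proof (cases "i \<in> C")
    case True
    have across: "adj_matrix \<bar>b\<bar> $ i $ j = 0" if "j \<notin> C" for j
      using that True component_mem_iff[OF assms(2), of i j] adj_matrix_abs_zero_across[OF assms(1)]
      by blast
    have "(laplacian \<bar>restrict_pairs C b\<bar> *v ?v) $ i = (laplacian \<bar>b\<bar> *v u) $ i"
      unfolding laplacian_mult using True across
      by (intro sum.cong refl) (simp add: adj_matrix_abs_restrict)
    then show ?thesis using True by (simp add: eig)
  next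
    case False
    then show ?thesis by (simp add: laplacian_mult adj_matrix_abs_restrict)
  qed
  then show ?thesis unfolding eigenspace_on_laplacian_restrict by (simp add: vec_eq_iff)
qed

lemma component_of_two_nodes_nontrivial:
  fixes s :: "'n::finite pvec"
  assumes "C \<in> components s" "i \<in> C" "j \<in> C" "i \<noteq> j"
  shows "C \<in> nontrivial_components s"
proof -
  have "card {i, j} \<le> card C" using assms by (intro card_mono) auto
  with assms show ?thesis by (simp add: nontrivial_components_def)
qed

section \<open>Spectrum of a Laplacian whose edges respect the target blocks\<close>

lemma laplacian_null_vector_blockwise_constant:
  assumes sub: "connected_rel b \<subseteq> connected_rel s"
    and lam: "\<And>C. C \<in> nontrivial_components s \<Longrightarrow> block_lambda2 b C > 0"
    and null: "laplacian \<bar>b\<bar> *v u = 0" and ij: "(i, j) \<in> connected_rel s"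
  shows "u $ i = u $ j"
proof (cases "i = j")
  case False
  define C where "C = connected_rel s `` {i}"
  have C: "C \<in> components s" "i \<in> C" "j \<in> C"
    using ij connected_class_in_components by (auto simp: C_def)
  have "block_lambda2 b C > 0" using lam component_of_two_nodes_nontrivial[OF C False] .
  moreover have "(\<chi> i. if i \<in> C then u $ i else 0) \<in> eigenspace_on C (laplacian \<bar>restrict_pairs C b\<bar>) 0"
    using eigenvector_restrict_component[OF sub C(1), of u 0] null by simp
  ultimately have "(\<chi> i. if i \<in> C then u $ i else 0) $ i = (\<chi> i. if i \<in> C then u $ i else 0) $ j"
    using C by (intro null_space_constant[of C b]) auto
  then show ?thesis using C by simp
qed simp

text \<open>
  Restrict the eigenvector to the block of a node where it does not vanish. This block has at least two
  nodes: an isolated node would give a zero row of the Laplacian and hence \<open>\<mu> = 0\<close>.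
\<close>

lemma laplacian_nonzero_eigenvalue_ge:
  assumes sub: "connected_rel b \<subseteq> connected_rel s" and c: "c > 0"
    and lam: "\<And>C. C \<in> nontrivial_components s \<Longrightarrow> block_lambda2 b C \<ge> c"
    and eig: "laplacian \<bar>b\<bar> *v u = \<mu> *\<^sub>R u" and nonzero: "u \<noteq> 0" "\<mu> \<noteq> 0"
  shows "\<mu> \<ge> c"
proof -
  obtain i where i: "u $ i \<noteq> 0" using nonzero by (auto simp: vec_eq_iff)
  define C where "C = connected_rel s `` {i}"
  have C: "C \<in> components s" "i \<in> C"
    using connected_class_in_components by (auto simp: C_def)
  have "\<exists>j. j \<in> C \<and> j \<noteq> i"
  proof (rule ccontr)
    assume "\<nexists>j. j \<in> C \<and> j \<noteq> i"
    then have "adj_matrix \<bar>b\<bar> $ i $ j * (u $ i - u $ j) = 0" for j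
      using adj_matrix_abs_zero_across[OF sub, of i j] by (auto simp: C_def)
    then have "(laplacian \<bar>b\<bar> *v u) $ i = 0" unfolding laplacian_mult by (intro sum.neutral) simp
    with eig i nonzero show False by simp
  qed
  then have nontriv: "C \<in> nontrivial_components s" using component_of_two_nodes_nontrivial C by metis
  let ?v = "\<chi> i. if i \<in> C then u $ i else 0"
  have "?v \<noteq> 0" using i C by (auto simp: vec_eq_iff)
  moreover have "C \<noteq> {}" "block_lambda2 b C > 0" using C c lam[OF nontriv] by auto
  ultimately have "\<mu> \<ge> block_lambda2 b C"
    using eigenvector_restrict_component[OF sub C(1) eig] nonzero(2)
    by (intro eigenvalue_ge_block_lambda2[of C b ?v \<mu>])
  with lam[OF nontriv] show ?thesis by linarith
qed

lemma laplacian_blockwise_constant_null: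
  assumes "connected_rel b \<subseteq> connected_rel s"
    and "\<And>i j. (i, j) \<in> connected_rel s \<Longrightarrow> u $ i = u $ j"
  shows "laplacian \<bar>b\<bar> *v u = 0"
proof -
  have "adj_matrix \<bar>b\<bar> $ i $ j * (u $ i - u $ j) = 0" for i j
    using adj_matrix_abs_zero_across[OF assms(1), of i j] assms(2)[of i j] by auto
  then have "(laplacian \<bar>b\<bar> *v u) $ i = 0" for i
    unfolding laplacian_mult by (intro sum.neutral) blast
  then show ?thesis by (simp add: vec_eq_iff)
qed

section \<open>The weights of an LLA step\<close>

text \<open>
  The left-hand side is the squared length of the projection of \<open>u = e_i - e_j\<close> onto the null space.
  The vector \<open>w = 1_C/|C| - 1_C'/|C'|\<close>, for the blocks \<open>C\<close> of \<open>i\<close> and \<open>C'\<close> of \<open>j\<close>, lies in the null space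
  and satisfies \<open>u \<bullet> w = w \<bullet> w = 1/|C| + 1/|C'|\<close>, so Cauchy-Schwarz bounds the squared length from below
  by this number.
\<close>

lemma sum_squares_null_coordinates_ge:
  fixes s :: "'n::finite pvec"
  assumes sub: "connected_rel b \<subseteq> connected_rel s"
    and sd: "spectral_decomposition (laplacian \<bar>b\<bar>) V ev"
    and ij: "(i, j) \<notin> connected_rel s"
  shows "(\<Sum>k | ev $ k = 0. (V $ i $ k - V $ j $ k)\<^sup>2) \<ge> 2 / real (max_component_size s)"
proof -
  \<comment> \<open>\<open>a i\<close> is the normalized indicator of the block of \<open>i\<close>, and \<open>d i\<close> below is its squared norm.\<close>
  define a where "a i l = (if (i, l) \<in> connected_rel s then 1 / real (card (connected_rel s `` {i})) else 0)"
    for i l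
  define w :: "real ^ 'n" where "w = (\<chi> l. a i l - a j l)"
  define u :: "real ^ 'n" where "u = axis i 1 - axis j 1"
  define N where "N = {k. ev $ k = 0}"
  define d where "d i = 1 / real (card (connected_rel s `` {i}))" for i
  have card_pos: "card (connected_rel s `` {i}) > 0" for i
  proof -
    have "i \<in> connected_rel s `` {i}" by simp
    then have "connected_rel s `` {i} \<noteq> {}" by blast
    then show ?thesis by (simp add: card_gt_0_iff)
  qed
  have symR: "sym (connected_rel s)" and transR: "trans (connected_rel s)"
    using equiv_connected_rel[of s] by (auto simp: equiv_def)
  have a_cong: "a i l = a i m" if "(l, m) \<in> connected_rel s" for i l m
    using that symR transR unfolding a_def by (metis symD transD)
  have "laplacian \<bar>b\<bar> *v w = 0"
    by (rule laplacian_blockwise_constant_null[OF sub]) (simp add: w_def a_cong)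
  then have w_orth: "column k V \<bullet> w = 0" if "k \<notin> N" for k
    using that eigenvector_orthogonal_column[OF transpose_laplacian sd, of w 0 k] by (simp add: N_def)
  have orthV: "orthogonal_matrix V" using sd by (simp add: spectral_decomposition_def)
  have parseval: "x \<bullet> w = (\<Sum>k\<in>N. (column k V \<bullet> x) * (column k V \<bullet> w))" for x
    unfolding orthogonal_matrix_parseval[OF orthV, of x w]
    using w_orth by (intro sum.mono_neutral_right) auto
  have square: "(\<Sum>l\<in>UNIV. a i l * a i l) = d i" for i
  proof -
    have "(\<Sum>l\<in>UNIV. a i l * a i l) = (\<Sum>l\<in>connected_rel s `` {i}. d i * d i)"
      by (intro sum.mono_neutral_cong_right) (auto simp: a_def d_def)
    then show ?thesis using card_pos[of i] by (simp add: d_def)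
  qed
  have disjoint: "a i l * a j l = 0" for l
    using ij symR transR unfolding a_def by (auto dest: symD transD)
  have ww: "w \<bullet> w = d i + d j"
  proof -
    have "w \<bullet> w = (\<Sum>l\<in>UNIV. a i l * a i l + a j l * a j l - 2 * (a i l * a j l))"
      by (simp add: w_def inner_vec_def algebra_simps)
    then show ?thesis by (simp add: disjoint sum.distrib square)
  qed
  have ii: "a i i = d i" for i by (simp add: a_def d_def)
  have "a i j = 0" "a j i = 0" using ij symR by (auto simp: a_def dest: symD)
  then have uw: "u \<bullet> w = d i + d j"
    by (simp add: u_def inner_diff_left inner_axis' w_def ii)
  have "(u \<bullet> w)\<^sup>2 \<le> (\<Sum>k\<in>N. (column k V \<bullet> u)\<^sup>2) * (w \<bullet> w)"
    using Cauchy_Schwarz_ineq_sum[of "\<lambda>k. column k V \<bullet> u" "\<lambda>k. column k V \<bullet> w" N]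
      parseval[of u] parseval[of w] by (simp only: power2_eq_square)
  moreover have d_pos: "d i > 0" for i using card_pos by (simp add: d_def)
  ultimately have "(\<Sum>k\<in>N. (column k V \<bullet> u)\<^sup>2) \<ge> d i + d j"
    unfolding uw ww power2_eq_square using d_pos[of i] d_pos[of j]
    by (meson add_pos_pos mult_le_cancel_right_pos)
  moreover have "d i \<ge> 1 / real (max_component_size s)" for i
  proof -
    have "finite (components s)" by (simp add: components_def)
    then have "card (connected_rel s `` {i}) \<le> max_component_size s"
      unfolding max_component_size_def using connected_class_in_components by (intro Max_ge) auto
    then show ?thesis using card_pos[of i] by (simp add: d_def frac_le)
  qed
  from this[of i] this[of j]
  have "d i + d j \<ge> 2 / real (max_component_size s)" by simp
  moreover have "column k V \<bullet> u = V $ i $ k - V $ j $ k" for k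
    by (simp add: u_def inner_diff_right inner_axis column_def)
  ultimately show ?thesis by (simp add: N_def)
qed

text \<open>
  Each term vanishes: null vectors do not distinguish \<open>i\<close> from \<open>j\<close>, and the other eigenvalues are in the
  range where \<open>p\<close> is zero.
\<close>

lemma lla_weights_zero_within_blocks:
  assumes sub: "connected_rel b \<subseteq> connected_rel s" and c: "c > 0"
    and lam: "\<And>C. C \<in> nontrivial_components s \<Longrightarrow> block_lambda2 b C \<ge> c"
    and sd: "spectral_decomposition (laplacian \<bar>b\<bar>) V ev"
    and p: "\<And>t. t \<ge> c \<Longrightarrow> p t = 0"
    and e: "e \<in> block_pairs s"
  shows "lla_weights V (\<chi> k. p (ev $ k)) $ e = 0"
proof -
  obtain i j where ij: "e = {i, j}" "i \<noteq> j" "(i, j) \<in> connected_rel s"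
    using e by (auto simp: block_pairs_def)
  have "p (ev $ k) * (V $ i $ k - V $ j $ k)\<^sup>2 = 0" for k
  proof (cases "ev $ k = 0")
    case True
    have "laplacian \<bar>b\<bar> *v column k V = 0" using sd True by (simp add: spectral_decomposition_def)
    moreover have "block_lambda2 b C > 0" if "C \<in> nontrivial_components s" for C
      using lam[OF that] c by linarith
    ultimately have "column k V $ i = column k V $ j"
      using laplacian_null_vector_blockwise_constant[OF sub _ _ ij(3)] by blast
    then show ?thesis by (simp add: column_def)
  next
    case False
    have eig: "laplacian \<bar>b\<bar> *v column k V = ev $ k *\<^sub>R column k V" and "norm (column k V) = 1"
      using sd by (auto simp: spectral_decomposition_def orthogonal_matrix_orthonormal_columns)
    then have "column k V \<noteq> 0" by force
    then have "ev $ k \<ge> c" using laplacian_nonzero_eigenvalue_ge[OF sub c lam eig _ False] by blast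
    then show ?thesis by (simp add: p)
  qed
  then show ?thesis unfolding ij(1) lla_weights_pair[OF ij(2)] by (intro sum.neutral) simp
qed

text \<open>
  Only the null vectors contribute, each with coefficient \<open>p 0\<close>.
\<close>

lemma lla_weights_ge_across_blocks:
  fixes s :: "'n::finite pvec"
  assumes sub: "connected_rel b \<subseteq> connected_rel s" and c: "c > 0"
    and lam: "\<And>C. C \<in> nontrivial_components s \<Longrightarrow> block_lambda2 b C \<ge> c"
    and sd: "spectral_decomposition (laplacian \<bar>b\<bar>) V ev"
    and p: "\<And>t. t \<ge> c \<Longrightarrow> p t = 0" "p 0 \<ge> 0"
    and e: "e \<in> pairs - block_pairs s"
  shows "lla_weights V (\<chi> k. p (ev $ k)) $ e \<ge> 2 * p 0 / real (max_component_size s)"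
proof -
  have "card e = 2" using e by (simp add: pairs_def)
  then obtain i j where ij: "e = {i, j}" "i \<noteq> j" by (meson card_2_iff)
  then have nrel: "(i, j) \<notin> connected_rel s" using e by (simp add: block_pairs_iff)
  have vanish: "p (ev $ k) = 0" if "ev $ k \<noteq> 0" for k
  proof -
    have eig: "laplacian \<bar>b\<bar> *v column k V = ev $ k *\<^sub>R column k V" and "norm (column k V) = 1"
      using sd by (auto simp: spectral_decomposition_def orthogonal_matrix_orthonormal_columns)
    then have "column k V \<noteq> 0" by force
    then show ?thesis using laplacian_nonzero_eigenvalue_ge[OF sub c lam eig _ that] p(1) by blast
  qed
  have "2 * p 0 / real (max_component_size s) = p 0 * (2 / real (max_component_size s))" by simp
  also have "\<dots> \<le> p 0 * (\<Sum>k | ev $ k = 0. (V $ i $ k - V $ j $ k)\<^sup>2)"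
    by (intro mult_left_mono sum_squares_null_coordinates_ge[OF sub sd nrel] p(2))
  also have "\<dots> = (\<Sum>k\<in>UNIV. p (ev $ k) * (V $ i $ k - V $ j $ k)\<^sup>2)"
    unfolding sum_distrib_left using vanish by (intro sum.mono_neutral_cong_left) auto
  finally show ?thesis unfolding ij(1) lla_weights_pair[OF ij(2)] by simp
qed

section \<open>Convexity and the weighted problem\<close>

lemma subspace_pair_space: "subspace pair_space"
  by (auto simp: subspace_def pair_space_def)

lemma axis_in_pair_space: "e \<in> pairs \<Longrightarrow> axis e 1 \<in> pair_space"
  by (auto simp: pair_space_def axis_def)

lemma has_real_derivative_along_line:
  fixes loss :: "'n::finite pvec \<Rightarrow> real"
  assumes D: "(loss has_derivative D) (at x within pair_space)"
    and xh: "x \<in> pair_space" "h \<in> pair_space"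
  shows "((\<lambda>t. loss (x + t *\<^sub>R h)) has_real_derivative D h) (at 0)"
proof -
  have "(\<lambda>t. x + t *\<^sub>R h) ` UNIV \<subseteq> pair_space"
    using xh subspace_pair_space by (auto intro: subspace_add subspace_mul)
  then have "(loss has_derivative D) (at (x + 0 *\<^sub>R h) within (\<lambda>t. x + t *\<^sub>R h) ` UNIV)"
    using has_derivative_subset[OF D] by simp
  moreover have "((\<lambda>t. x + t *\<^sub>R h) has_derivative (\<lambda>t. t *\<^sub>R h)) (at 0)"
    by (auto intro!: derivative_eq_intros)
  ultimately have "((\<lambda>t. loss (x + t *\<^sub>R h)) has_derivative (\<lambda>t. D (t *\<^sub>R h))) (at 0)"
    using has_derivative_in_compose[where s = UNIV] by blast
  moreover have "D (t *\<^sub>R h) = D h * t" for t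
    using linear_cmul[OF has_derivative_linear[OF D]] by simp
  ultimately show ?thesis by (simp add: has_field_derivative_def)
qed

text \<open>
  On the segment from \<open>x\<close> to \<open>y\<close> this is the tangent inequality for convex functions of one variable.
  The function is only known to be differentiable within the subspace \<open>pair_space\<close>, which contains the
  whole line through \<open>x\<close> and \<open>y\<close> and every direction \<open>axis e 1\<close> with \<open>e \<in> pairs\<close>; on that subspace
  the derivative is determined by the partial derivatives.
\<close>

lemma convex_gradient_inequality:
  fixes loss :: "'n::finite pvec \<Rightarrow> real"
  assumes convex: "convex_on pair_space loss" and diff: "loss differentiable_on pair_space"
    and xy: "x \<in> pair_space" "y \<in> pair_space"
  shows "loss y \<ge> loss x + (\<Sum>e\<in>pairs. pair_gradient loss x $ e * (y $ e - x $ e))"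
proof -
  obtain D where D: "(loss has_derivative D) (at x within pair_space)"
    using diff xy unfolding differentiable_on_def differentiable_def by blast
  define h where "h = y - x"
  have h: "h \<in> pair_space" unfolding h_def using xy by (intro subspace_diff subspace_pair_space)
  have grad: "pair_gradient loss x $ e = D (axis e 1)" if "e \<in> pairs" for e
    using DERIV_imp_deriv[OF has_real_derivative_along_line[OF D xy(1) axis_in_pair_space[OF that]]] that
    by (simp add: pair_gradient_def)
  have line: "x + t *\<^sub>R h \<in> pair_space" for t
    using xy h subspace_pair_space by (intro subspace_add subspace_mul)
  have "convex_on UNIV (\<lambda>t. loss (x + t *\<^sub>R h))"
  proof (rule convex_onI)
    fix t a b :: real assume t: "0 < t" "t < 1"
    have "x + ((1 - t) *\<^sub>R a + t *\<^sub>R b) *\<^sub>R h = (1 - t) *\<^sub>R (x + a *\<^sub>R h) + t *\<^sub>R (x + b *\<^sub>R h)"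
      by (simp add: algebra_simps)
    then show "loss (x + ((1 - t) *\<^sub>R a + t *\<^sub>R b) *\<^sub>R h)
        \<le> (1 - t) * loss (x + a *\<^sub>R h) + t * loss (x + b *\<^sub>R h)"
      using convex_onD[OF convex, of t "x + a *\<^sub>R h" "x + b *\<^sub>R h"] t line by simp
  qed simp
  from convex_on_imp_above_tangent[OF this, of 0 1 "D h"]
  have "loss y - loss x \<ge> D h"
    using has_real_derivative_along_line[OF D xy(1) h] by (simp add: h_def)
  also have "D h = D (\<Sum>e\<in>UNIV. h $ e *\<^sub>R axis e 1)"
    using basis_expansion[of h] by (simp add: scalar_mult_eq_scaleR)
  also have "\<dots> = (\<Sum>e\<in>UNIV. h $ e * D (axis e 1))"
    using has_derivative_linear[OF D] by (simp add: linear_sum linear_cmul)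
  also have "\<dots> = (\<Sum>e\<in>pairs. pair_gradient loss x $ e * (y $ e - x $ e))"
    using h grad by (intro sum.mono_neutral_cong_right) (auto simp: pair_space_def h_def)
  finally show ?thesis by simp
qed

lemma the_minimizerI:
  assumes "P x" "\<And>y. P y \<Longrightarrow> y \<noteq> x \<Longrightarrow> f x < (f y :: real)"
  shows "the_minimizer f P x"
  unfolding the_minimizer_def is_arg_min_def using assms by (metis less_asym)

lemma the_minimizer_less:
  assumes "the_minimizer f P x" "P y" "y \<noteq> x"
  shows "f x < (f y :: real)"
proof -
  have "\<not> is_arg_min f P y" "is_arg_min f P x" using assms by (auto simp: the_minimizer_def)
  then obtain z where "P z" "f z < f y" using assms(2) by (auto simp: is_arg_min_def)
  moreover have "\<not> f z < f x" using \<open>is_arg_min f P x\<close> \<open>P z\<close> by (auto simp: is_arg_min_def)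
  ultimately show ?thesis by linarith
qed

lemma the_minimizer_feasible: "the_minimizer f P x \<Longrightarrow> P x"
  by (auto simp: the_minimizer_def is_arg_min_def)

text \<open>
  Across blocks the coefficient \<open>M $ e / 2\<close> of \<open>\<bar>y $ e\<bar>\<close> dominates the slope of the loss, so any
  nonzero coordinate there costs more than the loss can gain. If there is none, \<open>y\<close> competes in the
  problem that defines the oracle.
\<close>

lemma block_oracle_minimizes_lla_objective:
  fixes loss :: "'n::finite pvec \<Rightarrow> real"
  assumes convex: "convex_on pair_space loss" and diff: "loss differentiable_on pair_space"
    and oracle_min: "is_block_oracle loss s x"
    and grad: "\<forall>e \<in> block_pairs s. pair_gradient loss x $ e = 0"
    and M_in: "\<And>e. e \<in> block_pairs s \<Longrightarrow> M $ e = 0"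
    and M_out: "\<And>e. e \<in> pairs - block_pairs s \<Longrightarrow> \<bar>pair_gradient loss x $ e\<bar> < M $ e / 2"
  shows "the_minimizer (lla_objective loss M) (\<lambda>y. y \<in> pair_space) x"
proof (rule the_minimizerI)
  define T where "T = pairs - block_pairs s"
  have x: "x \<in> pair_space" "\<And>e. e \<in> T \<Longrightarrow> x $ e = 0"
    using the_minimizer_feasible[OF oracle_min[unfolded is_block_oracle_def]] by (auto simp: T_def)
  have fin: "finite T" by simp
  have restrict: "(\<Sum>e\<in>pairs. c e) = (\<Sum>e\<in>T. c e)" if "\<And>e. e \<in> block_pairs s \<Longrightarrow> c e = 0"
    for c :: "'n set \<Rightarrow> real"
    using that by (intro sum.mono_neutral_right) (auto simp: T_def)
  have objective: "lla_objective loss M y = loss y + (\<Sum>e\<in>T. M $ e / 2 * \<bar>y $ e\<bar>)" for y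
    unfolding lla_objective_def using M_in by (subst restrict) (auto simp: sum_distrib_left)
  show "x \<in> pair_space" by (rule x)
  fix y assume y: "y \<in> pair_space" "y \<noteq> x"
  show "lla_objective loss M x < lla_objective loss M y"
  proof (cases "\<forall>e\<in>T. y $ e = 0")
    case True
    have "loss x < loss y"
      using the_minimizer_less[OF oracle_min[unfolded is_block_oracle_def]] y True by (auto simp: T_def)
    then show ?thesis using True x by (simp add: objective)
  next
    case False
    then obtain e where e: "e \<in> T" "y $ e \<noteq> 0" by blast
    have bound: "- pair_gradient loss x $ e * y $ e \<le> \<bar>pair_gradient loss x $ e\<bar> * \<bar>y $ e\<bar>" for e
      by (metis abs_ge_self abs_minus_cancel abs_mult)
    have le: "0 \<le> pair_gradient loss x $ e * y $ e + M $ e / 2 * \<bar>y $ e\<bar>" if "e \<in> T" for e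
      using bound[of e] mult_right_mono[OF less_imp_le[OF M_out[OF that[unfolded T_def]]], of "\<bar>y $ e\<bar>"]
      by simp
    have "0 < pair_gradient loss x $ e * y $ e + M $ e / 2 * \<bar>y $ e\<bar>"
    proof -
      have "\<bar>pair_gradient loss x $ e\<bar> * \<bar>y $ e\<bar> < M $ e / 2 * \<bar>y $ e\<bar>"
        using M_out e unfolding T_def by (intro mult_strict_right_mono) auto
      with bound[of e] show ?thesis by linarith
    qed
    then have "0 < (\<Sum>e\<in>T. pair_gradient loss x $ e * y $ e + M $ e / 2 * \<bar>y $ e\<bar>)"
      using e(1) le fin by (intro sum_pos2) auto
    also have "\<dots> = (\<Sum>e\<in>T. pair_gradient loss x $ e * (y $ e - x $ e)) + (\<Sum>e\<in>T. M $ e / 2 * \<bar>y $ e\<bar>)"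
      unfolding sum.distrib using x(2) by simp
    also have "(\<Sum>e\<in>T. pair_gradient loss x $ e * (y $ e - x $ e)) \<le> loss y - loss x"
      using convex_gradient_inequality[OF convex diff x(1) y(1)] grad
      by (subst (asm) restrict) auto
    finally show ?thesis using x(2) by (simp add: objective)
  qed
qed

section \<open>Penalty derivatives and stationarity\<close>

lemma pen_deriv_scad_like:
  assumes "scad_like a0 a1 b1 b2 \<tau> g"
  shows "pen_deriv g 0 = a0 * \<tau>" and "b2 * \<tau> > 0 \<Longrightarrow> t \<ge> b2 * \<tau> \<Longrightarrow> pen_deriv g t = 0"
  using assms unfolding scad_like_def
  by (auto simp: pen_deriv_def[of _ 0] intro!: tendsto_Lim)

text \<open>
  Coordinatewise, \<open>z $ e * y $ e \<le> \<bar>y $ e\<bar>\<close> because of the bound on \<open>z $ e\<close>, with equality at \<open>y = x\<close>.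
\<close>

lemma l1_subgradient:
  fixes x :: "'n::finite pvec"
  assumes "x \<in> pair_space" "z \<in> pair_space"
    and "\<And>e. e \<in> pairs \<Longrightarrow> \<bar>z $ e\<bar> \<le> 1" "\<And>e. e \<in> pairs \<Longrightarrow> z $ e * x $ e = \<bar>x $ e\<bar>"
  shows "subgradient_on pair_space l1_norm x z"
  unfolding subgradient_on_def
proof (intro conjI ballI assms(1,2))
  fix y :: "'n pvec"
  have "z \<bullet> (y - x) = (\<Sum>e\<in>pairs. z $ e * (y $ e - x $ e))"
    unfolding inner_vec_def using assms(2)
    by (intro sum.mono_neutral_cong_right) (auto simp: pair_space_def)
  also have "\<dots> \<le> (\<Sum>e\<in>pairs. \<bar>y $ e\<bar> - \<bar>x $ e\<bar>)"
  proof (rule sum_mono)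
    fix e :: "'n set" assume e: "e \<in> pairs"
    have "z $ e * y $ e \<le> \<bar>z $ e\<bar> * \<bar>y $ e\<bar>" by (metis abs_ge_self abs_mult)
    also have "\<dots> \<le> 1 * \<bar>y $ e\<bar>" using assms(3)[OF e] by (intro mult_right_mono) auto
    finally show "z $ e * (y $ e - x $ e) \<le> \<bar>y $ e\<bar> - \<bar>x $ e\<bar>"
      using assms(4)[OF e] by (simp add: right_diff_distrib)
  qed
  finally show "l1_norm x + z \<bullet> (y - x) \<le> l1_norm y"
    by (simp add: l1_norm_def sum_subtractf)
qed

text \<open>
  On \<open>T\<close> the subgradient can be the sign, since it is multiplied by zero. On the other pairs
  \<open>x $ e = 0\<close>, and the value that solves the first-order condition has modulus less than \<open>1\<close>.
\<close>

lemma fcls_stationary_pointI: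
  fixes x :: "'n::finite pvec"
  assumes x: "x \<in> pair_space"
    and sd: "spectral_decomposition (laplacian \<bar>x\<bar>) V ev"
    and M: "M = lla_weights V (\<chi> k. pen_deriv g (ev $ k))"
    and inside: "\<And>e. e \<in> T \<Longrightarrow> pair_gradient loss x $ e = 0 \<and> M $ e = 0"
    and outside: "\<And>e. e \<in> pairs - T \<Longrightarrow> x $ e = 0 \<and> \<bar>pair_gradient loss x $ e\<bar> < M $ e / 2"
  shows "fcls_stationary_point loss g x"
proof -
  define z where "z = (\<chi> e. if e \<notin> pairs then 0
    else if e \<in> T then sgn (x $ e) else - 2 * pair_gradient loss x $ e / M $ e)"
  have M_pos: "M $ e > 0" if "e \<in> pairs - T" for e
    using outside[OF that] abs_ge_zero[of "pair_gradient loss x $ e"] by linarith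
  have "subgradient_on pair_space l1_norm x z"
  proof (rule l1_subgradient[OF x])
    show "z \<in> pair_space" by (simp add: z_def pair_space_def)
    fix e :: "'n set" assume e: "e \<in> pairs"
    show "\<bar>z $ e\<bar> \<le> 1"
    proof (cases "e \<in> T")
      case False
      then show ?thesis using e outside[of e] M_pos[of e] by (simp add: z_def abs_mult)
    qed (use e in \<open>simp add: z_def abs_sgn_eq\<close>)
    show "z $ e * x $ e = \<bar>x $ e\<bar>"
      using e outside[of e] by (cases "e \<in> T") (auto simp: z_def linordered_idom_class.abs_sgn mult.commute)
  qed
  moreover have "0 = pair_gradient loss x + (1/2) *\<^sub>R (\<chi> e. M $ e * z $ e)"
  proof -
    have "pair_gradient loss x $ e + 1/2 * (M $ e * z $ e) = 0" for e
    proof (cases "e \<in> pairs - T")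
      case True
      with M_pos[OF True] show ?thesis by (simp add: z_def)
    next
      case False
      then show ?thesis using inside[of e] by (auto simp: z_def pair_gradient_def)
    qed
    then show ?thesis by (simp add: vec_eq_iff)
  qed
  ultimately show ?thesis using x sd unfolding fcls_stationary_point_def Let_def M by blast
qed

section \<open>One LLA step reaches the block oracle\<close>

theorem theorem3p1:
  fixes loss :: "'n::finite pvec \<Rightarrow> real"
    and g :: "real \<Rightarrow> real"
    and a0 a1 b1 b2 \<tau> :: real
    and \<beta>s \<beta>o :: "'n pvec"
  assumes const_bounds: "a1 > 0" "a0 \<ge> a1" "b1 > 0" "b2 > b1"
    and g: "scad_like a0 a1 b1 b2 \<tau> g"
    and convex: "convex_on pair_space loss"
    and diff: "loss differentiable_on pair_space"
    and target: "\<beta>s \<in> pair_space"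
    and oracle_sol: "is_block_oracle loss \<beta>s \<beta>o"
    and oracle_grad: "\<forall>e \<in> block_pairs \<beta>s. pair_gradient loss \<beta>o $ e = 0"
  shows
    "(\<forall>\<beta>0 \<in> pair_space.
        block_support \<beta>0 \<le> block_support \<beta>s \<and>
        (\<forall>C \<in> nontrivial_components \<beta>s. block_lambda2 \<beta>0 C \<ge> b2 * \<tau>) \<and>
        max_norm_on (pairs - block_pairs \<beta>s) (pair_gradient loss \<beta>o)
          < a0 * \<tau> / real (max_component_size \<beta>s)
        \<longrightarrow> lla_step loss g \<beta>0 \<beta>o) \<and>
     ((\<forall>C \<in> nontrivial_components \<beta>s. block_lambda2 \<beta>o C \<ge> b2 * \<tau>) \<and>
        max_norm_on (pairs - block_pairs \<beta>s) (pair_gradient loss \<beta>o)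
          < a0 * \<tau> / real (max_component_size \<beta>s)
        \<longrightarrow> lla_fixed_point loss g \<beta>o \<and> fcls_stationary_point loss g \<beta>o)"
proof -
  define T where "T = pairs - block_pairs \<beta>s"
  define small where "small \<longleftrightarrow> max_norm_on T (pair_gradient loss \<beta>o)
    < a0 * \<tau> / real (max_component_size \<beta>s)"
  have weights: "(\<forall>e\<in>block_pairs \<beta>s. M $ e = 0) \<and> (\<forall>e\<in>T. \<bar>pair_gradient loss \<beta>o $ e\<bar> < M $ e / 2)"
    if small and sub: "connected_rel b \<subseteq> connected_rel \<beta>s"
      and lam: "\<forall>C \<in> nontrivial_components \<beta>s. block_lambda2 b C \<ge> b2 * \<tau>"
      and sd: "spectral_decomposition (laplacian \<bar>b\<bar>) V ev"
      and M: "M = lla_weights V (\<chi> k. pen_deriv g (ev $ k))" for b V ev M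
  proof -
    \<comment> \<open>A nonnegative norm lies strictly below a multiple of \<open>\<tau>\<close>, which is where the sign of \<open>\<tau>\<close> comes from.\<close>
    have "0 \<le> max_norm_on T (pair_gradient loss \<beta>o)"
      unfolding max_norm_on_def by (rule Max_ge) auto
    with \<open>small\<close> have "a0 * \<tau> / real (max_component_size \<beta>s) > 0"
      unfolding small_def by linarith
    then have "\<tau> > 0"
      using const_bounds by (simp add: zero_less_divide_iff zero_less_mult_iff)
    then have c: "b2 * \<tau> > 0" and p0: "pen_deriv g 0 \<ge> 0"
      using const_bounds pen_deriv_scad_like(1)[OF g] by auto
    note p = pen_deriv_scad_like(2)[OF g c]
    have "\<bar>pair_gradient loss \<beta>o $ e\<bar> < M $ e / 2" if "e \<in> T" for e
    proof -
      have "\<bar>pair_gradient loss \<beta>o $ e\<bar> \<le> max_norm_on T (pair_gradient loss \<beta>o)"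
        unfolding max_norm_on_def using that by (intro Max_ge) auto
      moreover have "M $ e \<ge> 2 * (a0 * \<tau>) / real (max_component_size \<beta>s)"
        using lla_weights_ge_across_blocks[where p = "pen_deriv g", OF sub c _ sd p p0] lam that
        unfolding M T_def pen_deriv_scad_like(1)[OF g] by blast
      ultimately show ?thesis using \<open>small\<close> unfolding small_def by simp
    qed
    moreover have "M $ e = 0" if "e \<in> block_pairs \<beta>s" for e
      unfolding M using lla_weights_zero_within_blocks[where p = "pen_deriv g", OF sub c _ sd p that] lam by blast
    ultimately show ?thesis by blast
  qed
  have step: "lla_step loss g b \<beta>o"
    if "small" "connected_rel b \<subseteq> connected_rel \<beta>s"
      "\<forall>C \<in> nontrivial_components \<beta>s. block_lambda2 b C \<ge> b2 * \<tau>" for b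
    unfolding lla_step_def
  proof (intro conjI allI impI)
    show "\<exists>V ev. spectral_decomposition (laplacian \<bar>b\<bar>) V ev"
      by (rule symmetric_matrix_spectral_decomposition_exists[OF transpose_laplacian])
    fix V ev assume sd: "spectral_decomposition (laplacian \<bar>b\<bar>) V ev"
    show "the_minimizer (lla_objective loss (lla_weights V (\<chi> k. pen_deriv g (ev $ k))))
        (\<lambda>x. x \<in> pair_space) \<beta>o"
      using weights[OF that sd refl] unfolding T_def
      by (intro block_oracle_minimizes_lla_objective[OF convex diff oracle_sol oracle_grad]) auto
  qed
  have feasible: "\<beta>o \<in> pair_space" "\<forall>e\<in>T. \<beta>o $ e = 0"
    using the_minimizer_feasible[OF oracle_sol[unfolded is_block_oracle_def]] by (auto simp: T_def)
  have sub: "connected_rel \<beta>o \<subseteq> connected_rel \<beta>s"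
    using feasible(2) unfolding T_def by (rule connected_rel_mono_of_zero_outside)
  have stationary: "fcls_stationary_point loss g \<beta>o"
    if small and lam: "\<forall>C \<in> nontrivial_components \<beta>s. block_lambda2 \<beta>o C \<ge> b2 * \<tau>"
  proof -
    obtain V ev where sd: "spectral_decomposition (laplacian \<bar>\<beta>o\<bar>) V ev"
      using symmetric_matrix_spectral_decomposition_exists[OF transpose_laplacian] by blast
    show ?thesis
      using weights[OF \<open>small\<close> sub lam sd refl] feasible oracle_grad
      by (intro fcls_stationary_pointI[OF feasible(1) sd refl, where T = "block_pairs \<beta>s"])
        (auto simp: T_def)
  qed
  show ?thesis
    unfolding block_support_le_iff lla_fixed_point_def T_def[symmetric] small_def[symmetric]
    using step stationary sub by blast
qed

end
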